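(* Let $G$ be a graph. For any edge $ab$ of $G$ (with $a \neq b$) where neither $a$ nor $b$ has a loop, $$q(G) = q(G-a) + q(G^{ab}-b) + \bigl((x-1)^2-1\bigr)\, q(G^{ab}-a-b),$$ and for any looped vertex $a$ of $G$, $$q(G) = q(G-a) + (x-1)\, q(G^a-a).$$
   Context: Graphs are finite and undirected; each vertex may carry at most one loop, there are no multiple edges, and the null graph (no vertices) is allowed. For $S\subseteq V(G)$, $G[S]$ is the subgraph induced by $S$ (keeping loops on vertices of $S$). The notation $G-a$, $G-a-b$ means deletion of the indicated vertices. The adjacency matrix of $G$ is regarded as a matrix over $\mathbb{F}_2$, with diagonal entry $1$ exactly at the looped vertices; $r(G)$ and $n(G)$ denote its rank and nullity over $\mathbb{F}_2$ (both $0$ for the null graph), so $r(G)+n(G)=|V(G)|$. The two-variable interlace polynomial is $$q(G)=q(G;x,y)=\sum_{S\subseteq V(G)}(x-1)^{r(G[S])}(y-1)^{n(G[S])}\in\mathbb{Z}[x,y].$$ Pivot: for distinct vertices $a,b$ of $G$, partition $V(G)\setminus\{a,b\}$ into classes: (C1) vertices adjacent to both $a$ and $b$; (C2) vertices adjacent to $a$ but not $b$; (C3) vertices adjacent to $b$ but not $a$; (C4) vertices adjacent to neither. The graph $G^{ab}$ has vertex set $V(G)$ and is obtained from $G$ by toggling (edge becomes non-edge and vice versa) every pair $uv$ where $u$ and $v$ lie in two different classes among (C1), (C2), (C3). All other adjacencies, and all loops, are unchanged. Local complementation: for a vertex $a$, let $\Gamma(a)$ be the set of neighbors of $a$ (with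 $a\in\Gamma(a)$ iff $a$ is looped). The graph $G^a$ is equal to $G$ except that the subgraph induced by $\Gamma(a)$ is replaced by its complement, i.e. all edges between distinct vertices of $\Gamma(a)$ and all loops at vertices of $\Gamma(a)$ are toggled. (Only $G^a-a$ is used, so what happens to the edges and loop at $a$ itself is irrelevant.) *)

theory Defs
  imports
    "HOL-Library.Z2"
    "HOL-Library.Function_Algebras"
    "HOL-Computational_Algebra.Polynomial"
    "Graph_Theory.Pair_Digraph"
    "Graph_Theory.Digraph_Component"
begin

section \<open>Looped graphs\<close>

text \<open>
  A finite undirected graph with at most one loop per vertex and no multiple edges is a
  \<^const>\<open>pair_pseudo_graph\<close>: a finite vertex set, possibly empty, with a symmetric set of
  ordered pairs of vertices as arcs. An edge \<open>uv\<close> is represented by both arcs \<open>(u, v)\<close>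
  and \<open>(v, u)\<close>, and a loop at \<open>v\<close> by the arc \<open>(v, v)\<close>.
\<close>

definition induced :: "'a pair_pre_digraph \<Rightarrow> 'a set \<Rightarrow> 'a pair_pre_digraph" where
  "induced G S = \<lparr>pverts = S, parcs = {e \<in> parcs G. fst e \<in> S \<and> snd e \<in> S}\<rparr>"

definition del_vertex :: "'a pair_pre_digraph \<Rightarrow> 'a \<Rightarrow> 'a pair_pre_digraph" where
  "del_vertex G a = induced G (pverts G - {a})"

lemma with_proj_induced: "with_proj (induced G S) = with_proj G \<restriction> S"
  by (simp add: induced_def with_proj_def induce_subgraph_def)

lemma (in pair_wf_digraph) with_proj_del_vertex:
  "with_proj (del_vertex G a) = pre_digraph.del_vert (with_proj G) a"
  by (auto simp: del_vertex_def induced_def with_proj_def pre_digraph.del_vert_def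
      dest: arc_fst_in_verts arc_snd_in_verts)

definition neighbours :: "'a pair_pre_digraph \<Rightarrow> 'a \<Rightarrow> 'a set" where
  "neighbours G a = {v \<in> pverts G. (a, v) \<in> parcs G}"

definition pivot :: "'a pair_pre_digraph \<Rightarrow> 'a \<Rightarrow> 'a \<Rightarrow> 'a pair_pre_digraph" where
  "pivot G a b =
    (let C1 = (neighbours G a \<inter> neighbours G b) - {a, b};
         C2 = (neighbours G a - neighbours G b) - {a, b};
         C3 = (neighbours G b - neighbours G a) - {a, b};
         T = C1 \<times> C2 \<union> C1 \<times> C3 \<union> C2 \<times> C3
     in \<lparr>pverts = pverts G, parcs = sym_diff (parcs G) (T \<union> T\<inverse>)\<rparr>)"

text \<open>
  The diagonal of \<open>neighbours G a \<times> neighbours G a\<close> accounts for the toggled loops.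
\<close>

definition local_complement :: "'a pair_pre_digraph \<Rightarrow> 'a \<Rightarrow> 'a pair_pre_digraph" where
  "local_complement G a =
    \<lparr>pverts = pverts G, parcs = sym_diff (parcs G) (neighbours G a \<times> neighbours G a)\<rparr>"


section \<open>Rank and nullity over the field with two elements\<close>

text \<open>
  Vectors and matrices are indexed by the vertices themselves, so no enumeration of the
  vertex set is needed. A vector over \<open>V\<close> is a function to \<^typ>\<open>bit\<close> that vanishes outside \<open>V\<close>,
  with the pointwise addition of \<^theory>\<open>HOL-Library.Function_Algebras\<close>.
\<close>

definition f2_scale :: "bit \<Rightarrow> ('a \<Rightarrow> bit) \<Rightarrow> 'a \<Rightarrow> bit" where
  "f2_scale c v = (\<lambda>i. c * v i)"

global_interpretation f2: vector_space f2_scale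
  by unfold_locales (auto simp: f2_scale_def fun_eq_iff algebra_simps)

definition adj_matrix :: "'a pair_pre_digraph \<Rightarrow> 'a \<Rightarrow> 'a \<Rightarrow> bit" where
  "adj_matrix G u v = of_bool ((u, v) \<in> parcs G)"

text \<open>As for matrices over a finite index type in HOL-Analysis, the rank is the dimension of
  the span of the rows; the nullity is the dimension of the null space.\<close>

definition rank2 :: "'a pair_pre_digraph \<Rightarrow> nat" where
  "rank2 G = f2.dim (adj_matrix G ` pverts G)"

definition null_space2 :: "'a pair_pre_digraph \<Rightarrow> ('a \<Rightarrow> bit) set" where
  "null_space2 G = {w. (\<forall>v. v \<notin> pverts G \<longrightarrow> w v = 0) \<and>
     (\<forall>u \<in> pverts G. (\<Sum>v \<in> pverts G. adj_matrix G u v * w v) = 0)}"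

definition nullity2 :: "'a pair_pre_digraph \<Rightarrow> nat" where
  "nullity2 G = f2.dim (null_space2 G)"


section \<open>The two-variable interlace polynomial\<close>

text \<open>The ring \<open>\<int>[x, y]\<close> is represented as \<open>\<int>[x][y]\<close>.\<close>

definition var_x :: "int poly poly" where
  "var_x = [:[:0, 1:]:]"

definition var_y :: "int poly poly" where
  "var_y = [:0, 1:]"

definition interlace :: "'a pair_pre_digraph \<Rightarrow> int poly poly" where
  "interlace G =
    (\<Sum>S \<in> Pow (pverts G).
       (var_x - 1) ^ rank2 (induced G S) * (var_y - 1) ^ nullity2 (induced G S))"

end

theory Submission
  imports Defs
begin

text \<open>
  Both recurrences come from block elimination in the adjacency matrix over the field with two
  elements. Subsets of the vertex set that avoid \<open>a\<close> contribute \<open>q(G - a)\<close>. For a subset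
  containing a nonsingular principal block through \<open>a\<close>, that block is eliminated, and its Schur
  complement is the adjacency matrix of a smaller graph.

  If \<open>a\<close> is looped, the block is the entry \<open>1\<close> at \<open>(a, a)\<close>. Eliminating it adds
  \<open>A\<^sub>u\<^sub>a A\<^sub>a\<^sub>v\<close> to the entry at \<open>(u, v)\<close>, which toggles exactly the pairs of neighbours of
  \<open>a\<close>: the Schur complement is \<open>G\<^sup>a\<close>. So \<open>G[T \<union> {a}]\<close> has rank one more than \<open>G\<^sup>a[T]\<close>
  (lemma \<open>rank2_local_complement\<close>).

  If \<open>a\<close> and \<open>b\<close> are adjacent and unlooped, the block on \<open>{a, b}\<close> is the exchange matrix, and
  eliminating it adds \<open>A\<^sub>a\<^sub>u A\<^sub>b\<^sub>v + A\<^sub>b\<^sub>u A\<^sub>a\<^sub>v\<close>. This is \<open>1\<close> exactly when the vectors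
  \<open>(A\<^sub>a\<^sub>u, A\<^sub>b\<^sub>u)\<close> and \<open>(A\<^sub>a\<^sub>v, A\<^sub>b\<^sub>v)\<close> are nonzero and distinct, that is, when \<open>u\<close> and \<open>v\<close> lie in
  different classes among (C1), (C2), (C3): the Schur complement is \<open>G\<^sup>a\<^sup>b\<close>. So
  \<open>G[T \<union> {a, b}]\<close> has rank two more than \<open>G\<^sup>a\<^sup>b[T]\<close> (lemma \<open>rank2_pivot_both\<close>). For the subsets
  that contain \<open>a\<close> but not \<open>b\<close>, the same matrix update is a congruence, so \<open>G[T \<union> {a}]\<close> and
  \<open>G\<^sup>a\<^sup>b[T \<union> {a}]\<close> have equal rank (lemma \<open>rank2_pivot_one\<close>). Together these subsets contribute
  the sum over \<open>T\<close> of the terms of \<open>G\<^sup>a\<^sup>b\<close> at \<open>T \<union> {a}\<close> and of \<open>(x - 1)\<^sup>2\<close> times those at \<open>T\<close>;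
  the former and the terms at \<open>T\<close>, taken once, make up \<open>q(G\<^sup>a\<^sup>b - b)\<close>.

  Each elimination removes as many vertices as it lowers the rank, so by rank-nullity
  (lemma \<open>rank2_plus_nullity2\<close>) the nullities agree and only ranks have to be followed.
\<close>

section \<open>Dimension and linear maps\<close>

lemma (in vector_space) dim_insert_notin_span:
  assumes "finite S" and "x \<notin> span S"
  shows "dim (insert x S) = Suc (dim S)"
proof -
  obtain B where B: "B \<subseteq> S" "independent B" "S \<subseteq> span B" "card B = dim S"
    using basis_exists by blast
  have fin: "finite B"
    using B(1) assms(1) by (rule finite_subset)
  have sp: "span B = span S"
    using B by (meson span_minimal span_mono subspace_span subset_antisym)
  have "independent (insert x B)"
    using B(2) assms(2) sp by (simp add: independent_insertI)
  moreover have "span (insert x B) = span (insert x S)"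
    using sp by (auto simp: span_insert)
  moreover have "x \<notin> B"
    using assms(2) sp span_base by blast
  ultimately show ?thesis
    using dim_eq_card[of "insert x B" "insert x S"] B(4) fin by simp
qed

text \<open>
  Row operations do not change the row space: each row \<open>f i\<close> may be altered by a combination of the
  fixed pivot rows \<open>R\<close>.
\<close>

lemma (in vector_space) span_Un_image_cong:
  assumes "\<And>i. i \<in> I \<Longrightarrow> f i - g i \<in> span R"
  shows "span (R \<union> f ` I) = span (R \<union> g ` I)"
proof -
  have *: "p ` I \<subseteq> span (R \<union> q ` I)" if "\<And>i. i \<in> I \<Longrightarrow> p i - q i \<in> span R" for p q
  proof
    fix y assume "y \<in> p ` I"
    then obtain i where i: "i \<in> I" "y = p i" by auto
    have "p i - q i \<in> span (R \<union> q ` I)"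
      using that[OF i(1)] span_mono[of R "R \<union> q ` I"] by auto
    moreover have "q i \<in> span (R \<union> q ` I)"
      using i by (auto intro: span_base)
    ultimately show "y \<in> span (R \<union> q ` I)"
      using span_add i(2) by fastforce
  qed
  have "g i - f i \<in> span R" if "i \<in> I" for i
    using span_neg[OF assms[OF that]] by simp
  then show ?thesis
    using *[of f g] *[of g f] assms
    unfolding span_eq by (auto intro: span_base)
qed

text \<open>
  A basis of the kernel extends to a basis of the domain, and \<open>f\<close> maps the added vectors to a basis
  of the image. The domain is given as the span of a finite set because the ambient space of vectors
  indexed by vertices has infinite dimension when the vertex type is infinite.
\<close>

lemma (in vector_space_pair) rank_nullity:
  assumes "Vector_Spaces.linear s1 s2 f" and "finite S"
  shows "vs2.dim (f ` vs1.span S) + vs1.dim {v \<in> vs1.span S. f v = 0} = vs1.dim S"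
proof -
  interpret f: Vector_Spaces.linear s1 s2 f by fact
  let ?K = "{v \<in> vs1.span S. f v = 0}"
  obtain B0 where B0: "B0 \<subseteq> ?K" "vs1.independent B0" "?K \<subseteq> vs1.span B0" "card B0 = vs1.dim ?K"
    using vs1.basis_exists by blast
  obtain B where B: "B0 \<subseteq> B" "B \<subseteq> vs1.span S" "vs1.independent B" "vs1.span S \<subseteq> vs1.span B"
    using vs1.maximal_independent_subset_extend[of B0 "vs1.span S"] B0 by auto
  have finB: "finite B"
    using vs1.independent_span_bound[OF assms(2) B(3,2)] by simp
  have spB: "vs1.span B = vs1.span S"
    using B by (metis vs1.span_mono vs1.span_span subset_antisym)
  have cardB: "card B = vs1.dim S"
    using vs1.dim_eq_card[OF spB B(3)] by simp
  define C where "C = B - B0"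
  have spCS: "vs1.span C \<subseteq> vs1.span S"
    using vs1.span_mono[of C B] spB C_def by auto
  \<comment> \<open>Such an \<open>x\<close> lies in the spans of two disjoint parts of a basis, so all its coordinates vanish.\<close>
  have zero: "x = 0" if x: "x \<in> vs1.span C" "f x = 0" for x
  proof -
    have x0: "x \<in> vs1.span B0"
      using x spCS B0(3) by blast
    have xB: "x \<in> vs1.span B"
      using x(1) spCS spB by blast
    have r0: "vs1.representation B x = vs1.representation B0 x"
      by (rule vs1.representation_extend) (use B x0 in auto)
    have rC: "vs1.representation B x = vs1.representation C x"
      by (rule vs1.representation_extend) (use B x C_def in auto)
    have "vs1.representation B x b = 0" for b
      using r0 rC vs1.representation_ne_zero[of B0 x b] vs1.representation_ne_zero[of C x b]
      unfolding C_def by force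
    then show "x = 0"
      using vs1.sum_nonzero_representation_eq[OF B(3) xB] by simp
  qed
  then have inj: "inj_on f (vs1.span C)"
    by (subst f.inj_on_iff_eq_0) auto
  have "vs2.independent (f ` C)"
    using vs1.independent_mono[OF B(3)] inj
    by (intro linear_independent_injective_image[OF assms(1)]) (auto simp: C_def)
  moreover have "vs2.span (f ` C) = vs2.span (f ` vs1.span S)"
  proof -
    have "f ` B0 \<subseteq> {0}"
      using B0(1) by auto
    then have "f ` B \<subseteq> insert 0 (f ` C)" "f ` C \<subseteq> f ` B"
      by (auto simp: C_def)
    then have "vs2.span (f ` C) = vs2.span (f ` B)"
      by (metis vs2.span_mono vs2.span_insert_0 subset_antisym)
    also have "\<dots> = f ` vs1.span S"
      by (simp add: f.span_image spB)
    finally show ?thesis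
      by (metis vs2.span_span)
  qed
  ultimately have "vs2.dim (f ` vs1.span S) = card (f ` C)"
    by (rule vs2.dim_eq_card[rotated])
  also have "\<dots> = card C"
    by (rule card_image) (rule inj_on_subset[OF inj vs1.span_superset])
  also have "\<dots> + card B0 = card B"
    using finB B(1) unfolding C_def
    by (metis card_Diff_subset card_mono finite_subset le_add_diff_inverse2)
  finally show ?thesis
    using B0(4) cardB by simp
qed

section \<open>Vectors over the field with two elements\<close>

text \<open>
  Addition and multiplication of bits are to be treated as field operations, not rewritten into
  exclusive or and conjunction, so that sums and ring identities simplify as usual.
\<close>

declare add_bit_eq_xor [simp del] mult_bit_eq_and [simp del]

global_interpretation f2_pair: vector_space_pair f2_scale f2_scale
  by unfold_locales

definition unit_vec :: "'a \<Rightarrow> 'a \<Rightarrow> bit" where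
  "unit_vec v = (\<lambda>i. of_bool (i = v))"

definition vecs_on :: "'a set \<Rightarrow> ('a \<Rightarrow> bit) set" where
  "vecs_on S = {w. \<forall>v. v \<notin> S \<longrightarrow> w v = 0}"

lemma subspace_vecs_on: "f2.subspace (vecs_on S)"
  by (auto simp: f2.subspace_def vecs_on_def f2_scale_def)

lemma span_subset_vecs_on: "X \<subseteq> vecs_on S \<Longrightarrow> f2.span X \<subseteq> vecs_on S"
  by (rule f2.span_minimal[OF _ subspace_vecs_on])

lemma notin_span_if_nonzero_coord:
  assumes "\<And>w. w \<in> X \<Longrightarrow> w i = 0" and "r i \<noteq> 0"
  shows "r \<notin> f2.span X"
proof
  assume "r \<in> f2.span X"
  moreover have "f2.span X \<subseteq> vecs_on (- {i})"
    using assms(1) by (intro span_subset_vecs_on) (auto simp: vecs_on_def)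
  ultimately show False
    using assms(2) by (auto simp: vecs_on_def)
qed

lemma span_unit_vecs:
  assumes "finite S"
  shows "f2.span (unit_vec ` S) = vecs_on S"
proof
  show "f2.span (unit_vec ` S) \<subseteq> vecs_on S"
    by (rule span_subset_vecs_on) (auto simp: vecs_on_def unit_vec_def)
  show "vecs_on S \<subseteq> f2.span (unit_vec ` S)"
  proof
    fix w assume w: "w \<in> vecs_on S"
    have "w = (\<Sum>v\<in>S. f2_scale (w v) (unit_vec v))"
    proof
      fix i
      have "(\<Sum>v\<in>S. f2_scale (w v) (unit_vec v)) i = (\<Sum>v\<in>S. f2_scale (w v) (unit_vec v) i)"
        using assms by (induction S) auto
      also have "\<dots> = (\<Sum>v\<in>S. if i = v then w v else 0)"
        by (rule sum.cong) (auto simp: f2_scale_def unit_vec_def)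
      also have "\<dots> = w i"
        using assms w by (auto simp: vecs_on_def)
      finally show "w i = (\<Sum>v\<in>S. f2_scale (w v) (unit_vec v)) i" ..
    qed
    also have "\<dots> \<in> f2.span (unit_vec ` S)"
      by (intro f2.span_sum f2.span_scale f2.span_base) auto
    finally show "w \<in> f2.span (unit_vec ` S)" .
  qed
qed

lemma dim_unit_vecs:
  assumes "finite S"
  shows "f2.dim (unit_vec ` S) = card S"
  using assms
proof (induction S)
  case empty
  show ?case
    using f2.dim_eq_card_independent[OF f2.independent_empty] by simp
next
  case (insert a S)
  have "unit_vec a \<notin> f2.span (unit_vec ` S)"
    by (rule notin_span_if_nonzero_coord[where i = a]) (use insert.hyps in \<open>auto simp: unit_vec_def\<close>)
  then show ?case
    using insert by (simp add: f2.dim_insert_notin_span)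
qed

section \<open>Rank and nullity of a graph\<close>

lemma pseudo_graph_arcs_sym:
  assumes "pair_pseudo_graph G"
  shows "(u, v) \<in> parcs G \<longleftrightarrow> (v, u) \<in> parcs G"
proof -
  interpret pair_pseudo_graph G by fact
  show ?thesis
    using pair_sym_arcs by (auto simp: symmetric_def dest: symD)
qed

lemma pseudo_graph_finite_verts: "pair_pseudo_graph G \<Longrightarrow> finite (pverts G)"
  by (simp add: pair_pseudo_graph_def pair_fin_digraph_def pair_fin_digraph_axioms_def)

lemma pseudo_graph_arc_in_verts:
  assumes "pair_pseudo_graph G" and "(u, v) \<in> parcs G"
  shows "u \<in> pverts G" and "v \<in> pverts G"
proof -
  interpret pair_pseudo_graph G by fact
  show "u \<in> pverts G" "v \<in> pverts G"
    using arc_fst_in_verts[OF assms(2)] arc_snd_in_verts[OF assms(2)] by auto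
qed

lemma pseudo_graphI:
  assumes "finite (pverts G)"
    and "parcs G \<subseteq> pverts G \<times> pverts G"
    and "\<And>u v. (u, v) \<in> parcs G \<Longrightarrow> (v, u) \<in> parcs G"
  shows "pair_pseudo_graph G"
proof unfold_locales
  show "finite (parcs G)"
    using assms(1,2) by (meson finite_SigmaI finite_subset)
  show "symmetric (with_proj G)"
    using assms(3) by (auto simp: symmetric_def arcs_ends_def arc_to_ends_def intro: symI)
qed (use assms in auto)

lemma pverts_induced [simp]: "pverts (induced G S) = S"
  by (simp add: induced_def)

lemma adj_matrix_induced:
  "adj_matrix (induced G S) u v = (if u \<in> S \<and> v \<in> S then adj_matrix G u v else 0)"
  by (simp add: adj_matrix_def induced_def)

lemma pseudo_graph_induced:
  assumes "pair_pseudo_graph G" and "S \<subseteq> pverts G"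
  shows "pair_pseudo_graph (induced G S)"
  using pseudo_graph_finite_verts[OF assms(1)] assms(2) pseudo_graph_arcs_sym[OF assms(1)]
  by (intro pseudo_graphI) (auto simp: induced_def intro: finite_subset)

lemma adj_matrix_sym:
  "pair_pseudo_graph G \<Longrightarrow> adj_matrix G u v = adj_matrix G v u"
  using pseudo_graph_arcs_sym[of G u v] by (simp add: adj_matrix_def)

text \<open>
  The linear map given by the adjacency matrix sends unit vectors to columns and has the null space
  as kernel. Its image is the column space, which symmetry identifies with the row space that
  defines the rank.
\<close>

lemma rank2_plus_nullity2:
  assumes "pair_pseudo_graph G"
  shows "rank2 G + nullity2 G = card (pverts G)"
proof -
  let ?V = "pverts G"
  have fin: "finite ?V"
    using assms by (rule pseudo_graph_finite_verts)
  define f where "f w = (\<lambda>u. if u \<in> ?V then \<Sum>v\<in>?V. adj_matrix G u v * w v else 0)"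
    for w :: "'a \<Rightarrow> bit"
  have lin: "Vector_Spaces.linear f2_scale f2_scale f"
    by (unfold_locales)
      (auto simp: f_def f2_scale_def fun_eq_iff sum.distrib sum_distrib_left algebra_simps)
  then interpret f: Vector_Spaces.linear f2_scale f2_scale f .
  have "f (unit_vec v) = adj_matrix G v" if "v \<in> ?V" for v
  proof
    fix u
    have "(\<Sum>v'\<in>?V. adj_matrix G u v' * unit_vec v v') = (\<Sum>v'\<in>?V. if v = v' then adj_matrix G u v' else 0)"
      by (rule sum.cong) (auto simp: unit_vec_def)
    also have "\<dots> = adj_matrix G u v"
      using fin that by simp
    finally show "f (unit_vec v) u = adj_matrix G v u"
      using pseudo_graph_arc_in_verts[OF assms, of v u] adj_matrix_sym[OF assms, of u v]
      by (auto simp: f_def adj_matrix_def)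
  qed
  then have "f ` unit_vec ` ?V = adj_matrix G ` ?V"
    by (simp add: image_image)
  then have rank: "rank2 G = f2.dim (f ` f2.span (unit_vec ` ?V))"
    by (simp add: rank2_def flip: f.span_image)
  have "null_space2 G = {v \<in> f2.span (unit_vec ` ?V). f v = 0}"
    by (auto simp: null_space2_def span_unit_vecs[OF fin] vecs_on_def f_def fun_eq_iff)
  then have "nullity2 G = f2.dim {v \<in> f2.span (unit_vec ` ?V). f v = 0}"
    by (simp add: nullity2_def)
  then show ?thesis
    using f2_pair.rank_nullity[OF lin, of "unit_vec ` ?V"] rank fin by (simp add: dim_unit_vecs)
qed

section \<open>Local complementation and pivoting as elimination\<close>

lemma adj_matrix_local_complement:
  assumes "u \<in> pverts G" and "v \<in> pverts G"
  shows "adj_matrix (local_complement G a) u v =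
    adj_matrix G u v + adj_matrix G a u * adj_matrix G a v"
  using assms by (auto simp: adj_matrix_def local_complement_def neighbours_def)

text \<open>
  Writing the toggling as a matrix update turns the three vertex classes into algebra: the added
  term is the determinant of the two vectors \<open>(A\<^sub>a\<^sub>u, A\<^sub>b\<^sub>u)\<close> and \<open>(A\<^sub>a\<^sub>v, A\<^sub>b\<^sub>v)\<close>, up to a sign that
  is invisible modulo two. It vanishes if one of them is zero, as in class (C4), or if they are equal.
\<close>

lemma adj_matrix_pivot:
  assumes "u \<in> pverts G - {a, b}" and "v \<in> pverts G - {a, b}"
  shows "adj_matrix (pivot G a b) u v =
    adj_matrix G u v + adj_matrix G a u * adj_matrix G b v + adj_matrix G b u * adj_matrix G a v"
  using assms by (auto simp: adj_matrix_def pivot_def neighbours_def Let_def)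

lemma adj_matrix_pivot_at:
  assumes "u \<in> {a, b} \<or> v \<in> {a, b}"
  shows "adj_matrix (pivot G a b) u v = adj_matrix G u v"
  using assms by (auto simp: adj_matrix_def pivot_def Let_def)

lemma pverts_local_complement [simp]: "pverts (local_complement G a) = pverts G"
  by (simp add: local_complement_def)

lemma pverts_pivot [simp]: "pverts (pivot G a b) = pverts G"
  by (simp add: pivot_def Let_def)

lemma pseudo_graph_local_complement:
  assumes "pair_pseudo_graph G"
  shows "pair_pseudo_graph (local_complement G a)"
proof (rule pseudo_graphI)
  show "parcs (local_complement G a) \<subseteq> pverts (local_complement G a) \<times> pverts (local_complement G a)"
    using pseudo_graph_arc_in_verts[OF assms] by (auto simp: local_complement_def neighbours_def)
  show "(v, u) \<in> parcs (local_complement G a)" if "(u, v) \<in> parcs (local_complement G a)" for u v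
    using that pseudo_graph_arcs_sym[OF assms, of u v] by (auto simp: local_complement_def)
qed (simp add: pseudo_graph_finite_verts[OF assms])

lemma pseudo_graph_pivot:
  assumes "pair_pseudo_graph G"
  shows "pair_pseudo_graph (pivot G a b)"
proof -
  have nbs: "neighbours G c \<subseteq> pverts G" for c
    by (auto simp: neighbours_def)
  obtain T where T: "T \<subseteq> pverts G \<times> pverts G"
    and arcs: "parcs (pivot G a b) = sym_diff (parcs G) (T \<union> T\<inverse>)"
  proof
    define C1 where "C1 = (neighbours G a \<inter> neighbours G b) - {a, b}"
    define C2 where "C2 = (neighbours G a - neighbours G b) - {a, b}"
    define C3 where "C3 = (neighbours G b - neighbours G a) - {a, b}"
    have "C1 \<subseteq> pverts G" "C2 \<subseteq> pverts G" "C3 \<subseteq> pverts G"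
      using nbs[of a] nbs[of b] by (auto simp: C1_def C2_def C3_def)
    then show "C1 \<times> C2 \<union> C1 \<times> C3 \<union> C2 \<times> C3 \<subseteq> pverts G \<times> pverts G"
      by blast
    show "parcs (pivot G a b) = sym_diff (parcs G)
        ((C1 \<times> C2 \<union> C1 \<times> C3 \<union> C2 \<times> C3) \<union> (C1 \<times> C2 \<union> C1 \<times> C3 \<union> C2 \<times> C3)\<inverse>)"
      by (simp only: pivot_def Let_def C1_def C2_def C3_def pair_pre_digraph.simps)
  qed
  show ?thesis
  proof (rule pseudo_graphI)
    show "parcs (pivot G a b) \<subseteq> pverts (pivot G a b) \<times> pverts (pivot G a b)"
      using T pseudo_graph_arc_in_verts[OF assms] unfolding arcs by auto
    show "(v, u) \<in> parcs (pivot G a b)" if "(u, v) \<in> parcs (pivot G a b)" for u v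
      using that pseudo_graph_arcs_sym[OF assms, of u v] unfolding arcs by blast
  qed (simp add: pseudo_graph_finite_verts[OF assms])
qed

lemma bit_double [simp]: "x + x = (0 :: bit)"
  by (cases x) auto

text \<open>
  Clearing column \<open>a\<close> with the row of \<open>a\<close> leaves the rows of the local complement, which vanish
  at \<open>a\<close>; the row of \<open>a\<close> does not, so it adds one dimension.
\<close>

lemma rank2_local_complement:
  assumes "pair_pseudo_graph G" and "(a, a) \<in> parcs G" and "T \<subseteq> pverts G - {a}"
  shows "rank2 (induced G (insert a T)) = Suc (rank2 (induced (local_complement G a) T))"
proof -
  let ?A = "adj_matrix (induced G (insert a T))"
  let ?B = "adj_matrix (induced (local_complement G a) T)"
  have fin: "finite T"
    using pseudo_graph_finite_verts[OF assms(1)] assms(3) by (auto intro: finite_subset)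
  have Aaa: "adj_matrix G a a = 1"
    using assms(2) by (simp add: adj_matrix_def)
  have "?A u - ?B u \<in> f2.span {?A a}" if u: "u \<in> T" for u
  proof -
    have "?A u - ?B u = f2_scale (adj_matrix G a u) (?A a)"
      using u assms(3) Aaa adj_matrix_sym[OF assms(1), of u a]
      by (auto simp: fun_eq_iff f2_scale_def adj_matrix_induced adj_matrix_local_complement subset_iff)
    then show ?thesis
      by (simp add: f2.span_scale f2.span_base)
  qed
  then have "f2.span ({?A a} \<union> ?A ` T) = f2.span ({?A a} \<union> ?B ` T)"
    by (rule f2.span_Un_image_cong)
  then have "f2.dim (insert (?A a) (?A ` T)) = f2.dim (insert (?A a) (?B ` T))"
    by (auto intro: f2.span_eq_dim)
  also have "?A a \<notin> f2.span (?B ` T)"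
    by (rule notin_span_if_nonzero_coord[where i = a])
      (use assms(3) Aaa in \<open>auto simp: adj_matrix_induced\<close>)
  then have "f2.dim (insert (?A a) (?B ` T)) = Suc (f2.dim (?B ` T))"
    using fin by (simp add: f2.dim_insert_notin_span)
  finally show ?thesis
    by (simp add: rank2_def)
qed

text \<open>
  Row \<open>a\<close> clears column \<open>b\<close> and row \<open>b\<close> clears column \<open>a\<close>, which leaves the rows of the pivoted
  graph on \<open>T\<close>. Each of the two pivot rows then adds one dimension, as it is the only remaining row
  with a nonzero entry in the column that it cleared.
\<close>

lemma rank2_pivot_both:
  assumes "pair_pseudo_graph G" and "(a, b) \<in> parcs G"
    and "a \<noteq> b" and "(a, a) \<notin> parcs G" and "(b, b) \<notin> parcs G"
    and "T \<subseteq> pverts G - {a, b}"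
  shows "rank2 (induced G (insert a (insert b T))) = rank2 (induced (pivot G a b) T) + 2"
proof -
  let ?A = "adj_matrix (induced G (insert a (insert b T)))"
  let ?B = "adj_matrix (induced (pivot G a b) T)"
  have fin: "finite T"
    using pseudo_graph_finite_verts[OF assms(1)] assms(6) by (auto intro: finite_subset)
  have entries: "adj_matrix G a a = 0" "adj_matrix G b b = 0" "adj_matrix G a b = 1"
    "adj_matrix G b a = 1"
    using assms(2-5) pseudo_graph_arcs_sym[OF assms(1), of a b] by (simp_all add: adj_matrix_def)
  have "?A u - ?B u \<in> f2.span {?A a, ?A b}" if u: "u \<in> T" for u
  proof -
    have "?A u - ?B u = f2_scale (adj_matrix G b u) (?A a) + f2_scale (adj_matrix G a u) (?A b)"
      using u assms(3,6) entries adj_matrix_sym[OF assms(1), of u a] adj_matrix_sym[OF assms(1), of u b]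
      by (auto simp: fun_eq_iff f2_scale_def adj_matrix_induced adj_matrix_pivot subset_iff)
    moreover have "\<dots> \<in> f2.span {?A a, ?A b}"
      by (intro f2.span_add f2.span_scale f2.span_base) auto
    ultimately show ?thesis
      by simp
  qed
  then have "f2.span ({?A a, ?A b} \<union> ?A ` T) = f2.span ({?A a, ?A b} \<union> ?B ` T)"
    by (rule f2.span_Un_image_cong)
  then have "f2.dim (insert (?A a) (insert (?A b) (?A ` T))) =
      f2.dim (insert (?A a) (insert (?A b) (?B ` T)))"
    by (auto intro: f2.span_eq_dim)
  also have "?A b \<notin> f2.span (?B ` T)"
    by (rule notin_span_if_nonzero_coord[where i = a])
      (use assms(6) entries in \<open>auto simp: adj_matrix_induced\<close>)
  then have "f2.dim (insert (?A b) (?B ` T)) = Suc (f2.dim (?B ` T))"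
    using fin by (simp add: f2.dim_insert_notin_span)
  moreover have "?A a \<notin> f2.span (insert (?A b) (?B ` T))"
    by (rule notin_span_if_nonzero_coord[where i = b])
      (use assms(6) entries in \<open>auto simp: adj_matrix_induced\<close>)
  then have "f2.dim (insert (?A a) (insert (?A b) (?B ` T))) = Suc (f2.dim (insert (?A b) (?B ` T)))"
    using fin by (simp add: f2.dim_insert_notin_span)
  ultimately show ?thesis
    by (simp add: rank2_def)
qed

text \<open>
  Adding \<open>A\<^sub>b\<^sub>u\<close> times row \<open>a\<close> to each row \<open>u\<close>, and then doing the same to the columns, produces the
  matrix of the pivoted graph. The absence of a loop at \<open>a\<close> keeps row and column \<open>a\<close> themselves
  unchanged. The column operation is an injective linear map on rows, so it preserves the dimension
  of the row space. Here \<open>b\<close> enters only through its adjacencies: it is not in the induced subgraph.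
\<close>

lemma rank2_pivot_one:
  assumes "pair_pseudo_graph G" and "(a, a) \<notin> parcs G" and "T \<subseteq> pverts G - {a, b}"
  shows "rank2 (induced G (insert a T)) = rank2 (induced (pivot G a b) (insert a T))"
proof -
  let ?A = "adj_matrix (induced G (insert a T))"
  let ?B = "adj_matrix (induced (pivot G a b) (insert a T))"
  define c where "c = (\<lambda>v. if v \<in> T then adj_matrix G b v else 0)"
  \<comment> \<open>The column operation: column \<open>a\<close> times \<open>c v\<close> is added to each column \<open>v\<close>.\<close>
  define f where "f w = w + f2_scale (w a) c" for w :: "'a \<Rightarrow> bit"
  have fin: "finite T"
    using pseudo_graph_finite_verts[OF assms(1)] assms(3) by (auto intro: finite_subset)
  have aT: "a \<notin> T"
    using assms(3) by auto
  have Aaa: "adj_matrix G a a = 0"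
    using assms(2) by (simp add: adj_matrix_def)
  have lin: "Vector_Spaces.linear f2_scale f2_scale f"
    by unfold_locales (auto simp: f_def f2_scale_def fun_eq_iff algebra_simps)
  then interpret f: Vector_Spaces.linear f2_scale f2_scale f .
  have ker: "w = 0" if "f w = 0" for w
  proof -
    have "w v + w a * c v = 0" for v
      using fun_cong[OF that, of v] by (simp add: f_def f2_scale_def)
    from this[of a] this show ?thesis
      using aT by (auto simp: c_def fun_eq_iff split: if_splits)
  qed
  have dim_f: "f2.dim (f ` X) = f2.dim X" if "finite X" for X
  proof -
    have "{v \<in> f2.span X. f v = 0} = {0}"
      using ker f.zero f2.span_zero by auto
    moreover have "f2.dim {0 :: 'a \<Rightarrow> bit} = 0"
      using f2.dim_eq_card[of "{}" "{0 :: 'a \<Rightarrow> bit}"] by (simp add: f2.independent_empty)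
    ultimately show ?thesis
      using f2_pair.rank_nullity[OF lin that] by (simp flip: f.span_image)
  qed
  have Ba: "f (?A a) = ?B a"
    using Aaa by (auto simp: f_def f2_scale_def fun_eq_iff adj_matrix_induced adj_matrix_pivot_at)
  have "f (?A u) - ?B u \<in> f2.span {?B a}" if u: "u \<in> T" for u
  proof -
    have "f (?A u) - ?B u = f2_scale (adj_matrix G b u) (?B a)"
      using u aT assms(3) Aaa adj_matrix_sym[OF assms(1), of u a]
      by (auto simp: fun_eq_iff f_def c_def f2_scale_def adj_matrix_induced adj_matrix_pivot
          adj_matrix_pivot_at subset_iff)
    then show ?thesis
      by (simp add: f2.span_scale f2.span_base)
  qed
  then have "f2.span ({?B a} \<union> (\<lambda>u. f (?A u)) ` T) = f2.span ({?B a} \<union> ?B ` T)"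
    by (rule f2.span_Un_image_cong)
  then have "f2.dim (f ` ?A ` insert a T) = f2.dim (?B ` insert a T)"
    using Ba by (auto intro: f2.span_eq_dim simp: image_image)
  then show ?thesis
    using fin by (simp add: rank2_def dim_f del: image_insert)
qed

section \<open>The interlace polynomial\<close>

definition interlace_term :: "'a pair_pre_digraph \<Rightarrow> 'a set \<Rightarrow> int poly poly" where
  "interlace_term G S =
    (var_x - 1) ^ rank2 (induced G S) * (var_y - 1) ^ nullity2 (induced G S)"

text \<open>
  When \<open>k\<close> vertices and \<open>k\<close> units of rank are removed, the nullity is unchanged, so the terms differ
  exactly by a power of \<open>x - 1\<close>.
\<close>

lemma interlace_term_eqI:
  assumes "pair_pseudo_graph G" and "pair_pseudo_graph H"
    and "S \<subseteq> pverts G" and "T \<subseteq> pverts H"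
    and "rank2 (induced G S) = rank2 (induced H T) + k" and "card S = card T + k"
  shows "interlace_term G S = (var_x - 1) ^ k * interlace_term H T"
proof -
  have "nullity2 (induced G S) = nullity2 (induced H T)"
    using rank2_plus_nullity2[OF pseudo_graph_induced[OF assms(1,3)]]
      rank2_plus_nullity2[OF pseudo_graph_induced[OF assms(2,4)]] assms(5,6) by simp
  then show ?thesis
    by (simp add: interlace_term_def assms(5) power_add ac_simps)
qed

lemma sum_Pow_insert:
  assumes "finite W" and "a \<notin> W"
  shows "sum f (Pow (insert a W)) = sum f (Pow W) + (\<Sum>T\<in>Pow W. f (insert a T))"
proof -
  have "inj_on (insert a) (Pow W)"
    using assms(2) by (auto simp: inj_on_def)
  moreover have "Pow W \<inter> insert a ` Pow W = {}"
    using assms(2) by auto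
  ultimately show ?thesis
    using assms(1) by (simp add: Pow_insert sum.union_disjoint sum.reindex)
qed

lemma pverts_del_vertex [simp]: "pverts (del_vertex G a) = pverts G - {a}"
  by (simp add: del_vertex_def)

lemma induced_induced: "S \<subseteq> S' \<Longrightarrow> induced (induced G S') S = induced G S"
  by (auto simp: induced_def)

lemma interlace_eq_sum_terms: "interlace G = sum (interlace_term G) (Pow (pverts G))"
  by (simp add: interlace_def interlace_term_def)

lemma interlace_del_vertex:
  "interlace (del_vertex G a) = sum (interlace_term G) (Pow (pverts G - {a}))"
  unfolding interlace_def interlace_term_def
  by (intro sum.cong) (auto simp: del_vertex_def induced_induced)

lemma interlace_del_two_vertices:
  "interlace (del_vertex (del_vertex G a) b) = sum (interlace_term G) (Pow (pverts G - {a, b}))"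
proof -
  have "interlace_term (del_vertex G a) S = interlace_term G S" if "S \<subseteq> pverts G - {a, b}" for S
  proof -
    have "S \<subseteq> pverts G - {a}"
      using that by blast
    then show ?thesis
      by (simp add: interlace_term_def del_vertex_def induced_induced)
  qed
  moreover have "pverts G - {a} - {b} = pverts G - {a, b}"
    by blast
  ultimately show ?thesis
    by (simp add: interlace_del_vertex)
qed

lemma interlace_split:
  assumes "finite (pverts G)" and "a \<in> pverts G"
  shows "interlace G =
    interlace (del_vertex G a) + (\<Sum>T\<in>Pow (pverts G - {a}). interlace_term G (insert a T))"
  using sum_Pow_insert[of "pverts G - {a}" a "interlace_term G"] assms
  by (simp add: interlace_del_vertex insert_absorb interlace_eq_sum_terms[of G])

text \<open>
  Eliminating \<open>a\<close> lowers the rank by one in every subset that contains it, which is the source of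
  the single factor \<open>x - 1\<close>.
\<close>

theorem interlace_looped_vertex:
  assumes "pair_pseudo_graph G" and "(a, a) \<in> parcs G"
  shows "interlace G =
    interlace (del_vertex G a) + (var_x - 1) * interlace (del_vertex (local_complement G a) a)"
proof -
  have fin: "finite (pverts G)" and a: "a \<in> pverts G"
    using pseudo_graph_finite_verts[OF assms(1)] pseudo_graph_arc_in_verts[OF assms] by auto
  have "interlace_term G (insert a T) = (var_x - 1) ^ 1 * interlace_term (local_complement G a) T"
    if T: "T \<subseteq> pverts G - {a}" for T
  proof (rule interlace_term_eqI[OF assms(1) pseudo_graph_local_complement[OF assms(1)]])
    show "card (insert a T) = card T + 1"
      using T finite_subset[OF T] fin by (subst card_insert_disjoint) auto
  qed (use T a rank2_local_complement[OF assms T] in auto)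
  then have "(\<Sum>T\<in>Pow (pverts G - {a}). interlace_term G (insert a T)) =
      (var_x - 1) * interlace (del_vertex (local_complement G a) a)"
    by (simp add: interlace_del_vertex sum_distrib_left)
  then show ?thesis
    using interlace_split[OF fin a] by simp
qed

text \<open>
  The subsets containing \<open>a\<close> but not \<open>b\<close> occur in \<open>q(G\<^sup>a\<^sup>b - b)\<close> with the same terms. The other
  subsets counted by \<open>q(G\<^sup>a\<^sup>b - b)\<close> avoid both vertices and are in excess; this is the source of the
  \<open>- 1\<close> beside the factor \<open>(x - 1)\<^sup>2\<close>.
\<close>

theorem interlace_unlooped_edge:
  assumes "pair_pseudo_graph G" and "(a, b) \<in> parcs G"
    and "a \<noteq> b" and "(a, a) \<notin> parcs G" and "(b, b) \<notin> parcs G"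
  shows "interlace G =
    interlace (del_vertex G a)
    + interlace (del_vertex (pivot G a b) b)
    + ((var_x - 1)\<^sup>2 - 1) * interlace (del_vertex (del_vertex (pivot G a b) a) b)"
proof -
  let ?H = "pivot G a b" and ?W = "pverts G - {a, b}"
  have fin: "finite (pverts G)" and a: "a \<in> pverts G" and b: "b \<in> pverts G"
    using pseudo_graph_finite_verts[OF assms(1)] pseudo_graph_arc_in_verts[OF assms(1,2)] by auto
  note H = pseudo_graph_pivot[OF assms(1), of a b]
  have ins: "insert b ?W = pverts G - {a}" "insert a ?W = pverts G - {b}"
    using a b assms(3) by auto
  have one: "interlace_term G (insert a T) = interlace_term ?H (insert a T)" if T: "T \<subseteq> ?W" for T
  proof -
    have "interlace_term G (insert a T) = (var_x - 1) ^ 0 * interlace_term ?H (insert a T)"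
      by (rule interlace_term_eqI[OF assms(1) H])
        (use T a rank2_pivot_one[OF assms(1,4) T] in auto)
    then show ?thesis by simp
  qed
  have both: "interlace_term G (insert a (insert b T)) = (var_x - 1) ^ 2 * interlace_term ?H T"
    if T: "T \<subseteq> ?W" for T
  proof (rule interlace_term_eqI[OF assms(1) H])
    have "finite T" "a \<notin> T" "b \<notin> T"
      using T fin by (auto intro: finite_subset)
    then show "card (insert a (insert b T)) = card T + 2"
      using assms(3) by simp
  qed (use T a b rank2_pivot_both[OF assms T] in auto)
  have split_G: "(\<Sum>T\<in>Pow (pverts G - {a}). interlace_term G (insert a T)) =
      (\<Sum>T\<in>Pow ?W. interlace_term ?H (insert a T)) + (\<Sum>T\<in>Pow ?W. (var_x - 1)\<^sup>2 * interlace_term ?H T)"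
    using fin one both unfolding ins(1)[symmetric] by (subst sum_Pow_insert) auto
  have split_H: "interlace (del_vertex ?H b) =
      sum (interlace_term ?H) (Pow ?W) + (\<Sum>T\<in>Pow ?W. interlace_term ?H (insert a T))"
    using fin unfolding interlace_del_vertex pverts_pivot ins(2)[symmetric]
    by (subst sum_Pow_insert) auto
  show ?thesis
    using interlace_split[OF fin a] split_G split_H
    by (simp add: interlace_del_two_vertices left_diff_distrib flip: sum_distrib_left)
qed

theorem theorem6:
  fixes G :: "'a pair_pre_digraph"
  assumes "pair_pseudo_graph G"
  shows "(\<forall>a b. (a, b) \<in> parcs G \<and> a \<noteq> b \<and> (a, a) \<notin> parcs G \<and> (b, b) \<notin> parcs G \<longrightarrow>
           interlace G =
             interlace (del_vertex G a)
             + interlace (del_vertex (pivot G a b) b)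
             + ((var_x - 1)\<^sup>2 - 1) * interlace (del_vertex (del_vertex (pivot G a b) a) b)) \<and>
         (\<forall>a. (a, a) \<in> parcs G \<longrightarrow>
           interlace G =
             interlace (del_vertex G a)
             + (var_x - 1) * interlace (del_vertex (local_complement G a) a))"
  by (intro conjI allI impI; (elim conjE)?)
    (rule interlace_unlooped_edge[OF assms] interlace_looped_vertex[OF assms], assumption+)+

end
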